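(* Let $S=A\times B\subset\mathbb{R}^2$, where $A,B\subset\mathbb{R}$ are convex sets of size $n^{1/2}$ each. Then the number of unit-area triangles spanned by the points of $S$ is $O\left(n^{37/17}\log^{2/17} n\right)$.
   Context: A finite set $X=\{x_1,\ldots,x_m\}$ of real numbers, with $x_1<x_2<\cdots<x_m$, is called convex if $x_{i+1}-x_i>x_i-x_{i-1}$ for every $i=2,\ldots,m-1$. A unit-area triangle spanned by $S$ is a (non-degenerate) triangle of area $1$ whose three vertices are points of $S$. The constant hidden in $O(\cdot)$ is absolute (it does not depend on $n$, $A$, $B$); here $n\ge 2$ is such that $n^{1/2}$ is an integer. *)

theory Defs
  imports "HOL-Analysis.Analysis"
begin

(* "Convex" in the sense of additive combinatorics (strictly increasing consecutive gaps),
   unrelated to the library constant convex.  The list is the increasing enumeration of X;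
   indices are shifted to start at 0. *)
definition convex_real_set :: "real set \<Rightarrow> bool" where
  "convex_real_set X \<longleftrightarrow> finite X \<and>
     (let x = sorted_list_of_set X in
        \<forall>i. i + 2 < card X \<longrightarrow> x ! (i + 2) - x ! (i + 1) > x ! (i + 1) - x ! i)"

definition grid :: "real set \<Rightarrow> real set \<Rightarrow> (real ^ 2) set" where
  "grid A B = {vector [a, b] | a b. a \<in> A \<and> b \<in> B}"

(* A triangle is represented by its set of three vertices, so it is counted once,
   not once per ordering of the vertices. *)
definition unit_area_triangles :: "(real ^ 2) set \<Rightarrow> (real ^ 2) set set" where
  "unit_area_triangles S =
     {T. T \<subseteq> S \<and> card T = 3 \<and> \<not> collinear T \<and> measure lborel (convex hull T) = 1}"

end

theory Submission
  imports Defs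
begin

text \<open>
  Write \<open>N = sqrt n\<close>.  With vertices \<open>(a\<^sub>i, b\<^sub>i)\<close>, a unit-area triangle becomes, after possibly
  exchanging two vertices, a solution of
  \<open>(b\<^sub>3 - b\<^sub>1) (a\<^sub>2 - a\<^sub>1) - (b\<^sub>2 - b\<^sub>1) (a\<^sub>3 - a\<^sub>1) = 2\<close>.
  For a fixed \<open>a\<^sub>1\<close> this says that the point \<open>(a\<^sub>2 - a\<^sub>1, a\<^sub>3 - a\<^sub>1)\<close> of the Cartesian grid
  \<open>(A - a\<^sub>1) \<times> (A - a\<^sub>1)\<close> lies on the line \<open>v\<^sub>1 x - v\<^sub>2 y = 2\<close> with \<open>v = (b\<^sub>3 - b\<^sub>1, b\<^sub>2 - b\<^sub>1)\<close>.  Hence the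
  triangles are counted by \<open>N\<close> incidence problems, each between an \<open>N \<times> N\<close> grid and one common
  family of lines, where \<open>v\<close> has the weight \<open>w v\<close>, the number of triples of \<open>B\<close> that produce it.

  The weights have total \<open>N\<^sup>3\<close>, and the sum of their squares is the third energy \<open>\<Sum>\<^sub>d r(d)\<^sup>3\<close> of \<open>B\<close>,
  where \<open>r(d)\<close> counts the representations of \<open>d\<close> as a difference in \<open>B\<close>.  For a convex set this is
  \<open>O(N\<^sup>3 log N)\<close> (\<open>convex_third_energy_le\<close>), because at most \<open>O(N\<^sup>3 / k\<^sup>3)\<close> differences have
  \<open>k\<close> or more representations (\<open>convex_card_popular_diffs_le\<close>).  On the other side, if \<open>t v\<close> is the
  number of grid points on the line \<open>v\<close>, then the lines with \<open>t v \<ge> 8 m\<close> satisfy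
  \<open>\<Sum> (t v)\<^sup>2 = O(N\<^sup>4 / m)\<close> (\<open>sum_squares_rich_lines_le\<close>), which is the Szemeredi-Trotter bound for
  Cartesian grids.  Splitting \<open>\<Sum> w v * t v\<close> at \<open>t v = 8 m\<close> and using
  \<open>w t \<le> m w\<^sup>2 + t\<^sup>2 / m\<close> on the rich lines gives, for \<open>m\<close> of order \<open>N^(1/3)\<close>, at most
  \<open>O(N^(10/3) log N)\<close> incidences for each \<open>a\<^sub>1\<close>.  In total there are \<open>O(n^(13/6) log n)\<close> triangles, and
  \<open>13/6 < 37/17\<close> absorbs the logarithm.

  Both combinatorial bounds come from one elementary fact, \<open>close_pairs_on_monotone_chain\<close>: if \<open>t\<close>
  points of a \<open>K \<times> M\<close> grid follow each other monotonically in both coordinates, then all but at most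
  \<open>2 r\<close> of the \<open>t - 1\<close> consecutive pairs have coordinate gaps at most \<open>K / r\<close> and \<open>M / r\<close>.  The grid has few such
  close pairs, and each of them lies on at most one line, respectively comes from at most one
  translate of \<open>B\<close>, so many rich lines or translates cannot coexist.
\<close>

section \<open>Close consecutive pairs on a monotone chain\<close>

text \<open>
  The gaps of a monotone sequence add up to its total variation, which is at most \<open>K\<close>.
\<close>

lemma few_long_gaps:
  fixes u :: "nat \<Rightarrow> int" and n r :: nat and K :: int
  assumes mono: "mono_on {..n} u \<or> antimono_on {..n} u"
    and range: "\<And>i. i \<le> n \<Longrightarrow> 0 \<le> u i \<and> u i \<le> K"
  shows "card {i. i < n \<and> K < int r * \<bar>u (Suc i) - u i\<bar>} \<le> r"
proof -
  let ?J = "{i. i < n \<and> K < int r * \<bar>u (Suc i) - u i\<bar>}"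
  have fin: "finite ?J" by simp
  have K0: "0 \<le> K" using range[of 0] by linarith
  have total: "(\<Sum>i<n. \<bar>u (Suc i) - u i\<bar>) = \<bar>u n - u 0\<bar>"
    using mono
  proof
    assume m: "mono_on {..n} u"
    have "(\<Sum>i<n. \<bar>u (Suc i) - u i\<bar>) = (\<Sum>i<n. u (Suc i) - u i)"
      by (intro sum.cong refl abs_of_nonneg) (use m in \<open>auto simp: monotone_on_def\<close>)
    also have "\<dots> = u n - u 0" by (simp add: sum_lessThan_telescope)
    finally show ?thesis using m by (auto simp: monotone_on_def)
  next
    assume m: "antimono_on {..n} u"
    have "(\<Sum>i<n. \<bar>u (Suc i) - u i\<bar>) = (\<Sum>i<n. - (u (Suc i) - u i))"
      by (intro sum.cong refl abs_of_nonpos) (use m in \<open>auto simp: monotone_on_def\<close>)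
    also have "\<dots> = - (u n - u 0)" by (simp only: sum_negf sum_lessThan_telescope)
    finally show ?thesis using m by (auto simp: monotone_on_def)
  qed
  have "int (card ?J) * (K + 1) = (\<Sum>i\<in>?J. K + 1)" by simp
  also have "\<dots> \<le> (\<Sum>i\<in>?J. int r * \<bar>u (Suc i) - u i\<bar>)" by (intro sum_mono) auto
  also have "\<dots> \<le> (\<Sum>i<n. int r * \<bar>u (Suc i) - u i\<bar>)" by (intro sum_mono2) auto
  also have "\<dots> = int r * \<bar>u n - u 0\<bar>" by (simp add: sum_distrib_left[symmetric] total)
  also have "\<dots> \<le> int r * (K + 1)"
    using range[of 0] range[of n] by (intro mult_left_mono) auto
  finally show ?thesis using K0 by simp
qed

text \<open>
  Among consecutive elements of \<open>Q\<close> at most \<open>r\<close> have a long gap in \<open>u\<close> and at most \<open>r\<close> have one in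
  \<open>v\<close>; the remaining consecutive pairs are close in both.  The two coordinates may run in opposite
  directions, as they do along a line of negative slope.
\<close>

lemma close_pairs_on_monotone_chain:
  fixes Q :: "'a::linorder set" and u v :: "'a \<Rightarrow> int" and r :: nat
  assumes fin: "finite Q"
    and u: "mono_on Q u \<or> antimono_on Q u" and v: "mono_on Q v \<or> antimono_on Q v"
    and uK: "\<And>q. q \<in> Q \<Longrightarrow> 0 \<le> u q \<and> u q \<le> K"
    and vM: "\<And>q. q \<in> Q \<Longrightarrow> 0 \<le> v q \<and> v q \<le> M"
  shows "card Q \<le> 1 + 2 * r + card {(p, q) \<in> Q \<times> Q. p < q \<and>
           int r * \<bar>u q - u p\<bar> \<le> K \<and> int r * \<bar>v q - v p\<bar> \<le> M}" (is "_ \<le> _ + card ?C")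
proof (cases "Q = {}")
  case False
  define xs where "xs = sorted_list_of_set Q"
  define n where "n = card Q - 1"
  have len: "length xs = Suc n" using False fin by (simp add: xs_def n_def card_gt_0_iff)
  have lt: "xs ! i < xs ! j" if "i < j" "j \<le> n" for i j
    using that len sorted_wrt_nth_less[of "(<)" xs i j] by (simp add: xs_def)
  have mem: "xs ! i \<in> Q" if "i \<le> n" for i
    using that len fin nth_mem[of i xs] by (simp add: xs_def)
  have le: "xs ! i \<le> xs ! j" if "i \<le> j" "j \<le> n" for i j
    using that lt[of i j] by (cases "i = j") auto
  have inj: "i = j" if "(xs ! i, xs ! Suc i) = (xs ! j, xs ! Suc j)" "i \<le> n" "j \<le> n" for i j
    using that lt[of i j] lt[of j i] by (cases i j rule: linorder_cases) auto
  have pull: "mono_on {..n} (\<lambda>i. f (xs ! i)) \<or> antimono_on {..n} (\<lambda>i. f (xs ! i))"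
    if "mono_on Q f \<or> antimono_on Q f" for f :: "'a \<Rightarrow> int"
    using that
  proof
    assume m: "mono_on Q f"
    have "mono_on {..n} (\<lambda>i. f (xs ! i))"
      by (rule monotone_onI) (use m mem le in \<open>auto simp: monotone_on_def\<close>)
    then show ?thesis ..
  next
    assume m: "antimono_on Q f"
    have "antimono_on {..n} (\<lambda>i. f (xs ! i))"
      by (rule monotone_onI) (use m mem le in \<open>auto simp: monotone_on_def\<close>)
    then show ?thesis ..
  qed
  let ?G = "\<lambda>f L. {i. i < n \<and> L < int r * \<bar>f (xs ! Suc i) - f (xs ! i)\<bar>}"
  have gu: "card (?G u K) \<le> r" by (rule few_long_gaps[OF pull[OF u]]) (use uK mem in auto)
  have gv: "card (?G v M) \<le> r" by (rule few_long_gaps[OF pull[OF v]]) (use vM mem in auto)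
  let ?S = "{..<n} - (?G u K \<union> ?G v M)"
  have "n - (card (?G u K) + card (?G v M)) \<le> card {..<n} - card (?G u K \<union> ?G v M)"
    using diff_le_mono2[OF card_Un_le[of "?G u K" "?G v M"]] by simp
  also have "\<dots> \<le> card ?S" by (rule diff_card_le_card_Diff) simp
  also have "card ?S \<le> card ?C"
  proof (rule card_inj_on_le)
    show "inj_on (\<lambda>i. (xs ! i, xs ! Suc i)) ?S"
      by (rule inj_onI) (rule inj; simp)
    show "(\<lambda>i. (xs ! i, xs ! Suc i)) ` ?S \<subseteq> ?C"
      using mem lt by auto
    show "finite ?C" by (rule finite_subset[of _ "Q \<times> Q"]) (use fin in auto)
  qed
  finally show ?thesis using gu gv unfolding n_def by linarith
qed simp

text \<open>
  Closeness of two points is measured by their positions in the set and not by their distance, so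
  that the number of close neighbours of a point has a bound that does not depend on the spacing.  The rank is defined for all reals, which
  makes monotonicity available along a whole line.
\<close>

definition rank_in :: "real set \<Rightarrow> real \<Rightarrow> int" where
  "rank_in X x = int (card {z \<in> X. z < x})"

lemma rank_bounds: "finite X \<Longrightarrow> 0 \<le> rank_in X x \<and> rank_in X x \<le> int (card X)"
  by (auto simp: rank_in_def intro!: card_mono)

lemma rank_mono: "finite X \<Longrightarrow> x \<le> y \<Longrightarrow> rank_in X x \<le> rank_in X y"
  by (auto simp: rank_in_def intro!: card_mono)

lemma rank_strict_mono:
  assumes "finite X" "x \<in> X" "x < y" shows "rank_in X x < rank_in X y"
  unfolding rank_in_def of_nat_less_iff by (rule psubset_card_mono) (use assms in auto)

lemma inj_on_rank: "finite X \<Longrightarrow> inj_on (rank_in X) X"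
  by (rule inj_onI) (metis linorder_neqE order_less_irrefl rank_strict_mono)

lemma card_close_rank:
  assumes "finite X" "0 < r"
  shows "card {y \<in> X. int r * \<bar>rank_in X y - a\<bar> \<le> int (card X)} \<le> 2 * (card X div r) + 1"
proof -
  let ?g = "int (card X div r)"
  have "card {y \<in> X. int r * \<bar>rank_in X y - a\<bar> \<le> int (card X)} \<le> card {a - ?g..a + ?g}"
  proof (rule card_inj_on_le[where f = "rank_in X"])
    show "inj_on (rank_in X) {y \<in> X. int r * \<bar>rank_in X y - a\<bar> \<le> int (card X)}"
      by (rule inj_on_subset[OF inj_on_rank[OF assms(1)]]) auto
    have "\<bar>k - a\<bar> \<le> ?g" if "int r * \<bar>k - a\<bar> \<le> int (card X)" for k
    proof -
      have "(int r * \<bar>k - a\<bar>) div int r \<le> int (card X) div int r"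
        by (rule zdiv_mono1) (use that assms in auto)
      then show ?thesis using assms by (simp add: zdiv_int)
    qed
    then show "rank_in X ` {y \<in> X. int r * \<bar>rank_in X y - a\<bar> \<le> int (card X)} \<subseteq> {a - ?g..a + ?g}"
      by (fastforce simp: abs_le_iff)
  qed simp
  then show ?thesis by simp
qed

lemma card_close_rank_real:
  assumes "finite X" "0 < r" "r \<le> card X"
  shows "real (card {y \<in> X. int r * \<bar>rank_in X y - a\<bar> \<le> int (card X)}) \<le> 3 * real (card X) / real r"
proof -
  have "real (card {y \<in> X. int r * \<bar>rank_in X y - a\<bar> \<le> int (card X)}) \<le> 2 * real (card X div r) + 1"
    using card_close_rank[OF assms(1,2), of a] by linarith
  also have "\<dots> \<le> 2 * (real (card X) / real r) + real (card X) / real r"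
    using assms of_nat_div_le_of_nat[of "card X" r, where 'a = real] by (intro add_mono mult_left_mono) auto
  finally show ?thesis by simp
qed

section \<open>Rich lines in a Cartesian grid\<close>

text \<open>
  The pair \<open>v\<close> encodes the line \<open>v\<^sub>1 x - v\<^sub>2 y = 2\<close>; the constant is twice the unit area.
  The pair \<open>0\<close> encodes the empty set.
\<close>

definition line_points :: "real set \<Rightarrow> real \<times> real \<Rightarrow> (real \<times> real) set" where
  "line_points X v = {p \<in> X \<times> X. fst v * fst p - snd v * snd p = 2}"

lemma finite_line_points: "finite X \<Longrightarrow> finite (line_points X v)"
  by (auto simp: line_points_def)

definition close_pairs :: "real set \<Rightarrow> nat \<Rightarrow> ((real \<times> real) \<times> (real \<times> real)) set" where
  "close_pairs X r = {(p, q). p \<in> X \<times> X \<and> q \<in> X \<times> X \<and> p \<noteq> q \<and>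
     int r * \<bar>rank_in X (fst q) - rank_in X (fst p)\<bar> \<le> int (card X) \<and>
     int r * \<bar>rank_in X (snd q) - rank_in X (snd p)\<bar> \<le> int (card X)}"

lemma finite_close_pairs: "finite X \<Longrightarrow> finite (close_pairs X r)"
  by (rule finite_subset[of _ "(X \<times> X) \<times> (X \<times> X)"]) (auto simp: close_pairs_def)

text \<open>
  Both coordinates are monotone along a line, so the grid points on it form a chain to which
  \<open>close_pairs_on_monotone_chain\<close> applies.
\<close>

lemma card_line_points_le:
  assumes fin: "finite X"
  shows "card (line_points X v) \<le> 1 + 2 * r
           + card (close_pairs X r \<inter> line_points X v \<times> line_points X v)"
proof (cases "v = 0")
  case True
  then show ?thesis by (simp add: line_points_def zero_prod_def)
next
  case False
  obtain a b where v: "v = (a, b)" by (cases v)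
  (* The line has direction (b, a).  It is parametrised by the inner product s with this direction,
     which treats horizontal and vertical lines like all others; each coordinate is then an affine
     function of s. *)
  define D where "D = a\<^sup>2 + b\<^sup>2"
  have D: "D > 0" using False v by (auto simp: D_def zero_prod_def sum_power2_gt_zero_iff)
  define pt where "pt s = ((2 * a + b * s) / D, (a * s - 2 * b) / D)" for s
  define key where "key p = b * fst p + a * snd p" for p :: "real \<times> real"
  have pt_key: "pt (key p) = p" if "p \<in> line_points X v" for p
  proof (cases p)
    case (Pair x y)
    have e: "a * x - b * y = 2" using that v Pair by (simp add: line_points_def)
    have "(a * x - b * y) * a + b * (b * x + a * y) = x * D"
      unfolding D_def by (simp add: algebra_simps power2_eq_square)
    moreover have "a * (b * x + a * y) - (a * x - b * y) * b = y * D"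
      unfolding D_def by (simp add: algebra_simps power2_eq_square)
    ultimately have "2 * a + b * (b * x + a * y) = x * D" "a * (b * x + a * y) - 2 * b = y * D"
      by (simp_all only: e)
    then have "pt (key p) = p" using D by (simp add: pt_def key_def Pair)
    then show ?thesis .
  qed
  have key_pt: "key (pt s) = s" for s
  proof -
    have "b * (2 * a + b * s) + a * (a * s - 2 * b) = s * D" unfolding D_def by algebra
    then show ?thesis using D by (simp add: key_def pt_def add_divide_distrib[symmetric])
  qed
  have pt_neq: "pt s \<noteq> pt t" if "s < t" for s t using key_pt[of s] key_pt[of t] that by force
  define Q where "Q = key ` line_points X v"
  have finQ: "finite Q" using fin by (simp add: Q_def finite_line_points)
  have ptQ: "pt s \<in> line_points X v" if "s \<in> Q" for s
    using that by (auto simp: Q_def pt_key)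
  have cardQ: "card Q = card (line_points X v)"
    unfolding Q_def by (rule card_image) (metis inj_onI pt_key)
  have mono1: "mono_on Q (\<lambda>s. rank_in X (fst (pt s))) \<or> antimono_on Q (\<lambda>s. rank_in X (fst (pt s)))"
    using D by (cases "b \<ge> 0")
      (auto simp: monotone_on_def pt_def divide_right_mono mult_left_mono mult_left_mono_neg intro!: rank_mono fin)
  have mono2: "mono_on Q (\<lambda>s. rank_in X (snd (pt s))) \<or> antimono_on Q (\<lambda>s. rank_in X (snd (pt s)))"
    using D by (cases "a \<ge> 0")
      (auto simp: monotone_on_def pt_def divide_right_mono mult_left_mono mult_left_mono_neg intro!: rank_mono fin)
  let ?C = "{(s, t) \<in> Q \<times> Q. s < t \<and>
     int r * \<bar>rank_in X (fst (pt t)) - rank_in X (fst (pt s))\<bar> \<le> int (card X) \<and>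
     int r * \<bar>rank_in X (snd (pt t)) - rank_in X (snd (pt s))\<bar> \<le> int (card X)}"
  have "card Q \<le> 1 + 2 * r + card ?C"
    by (rule close_pairs_on_monotone_chain[OF finQ mono1 mono2]) (use rank_bounds[OF fin] in auto)
  moreover have "card ?C \<le> card (close_pairs X r \<inter> line_points X v \<times> line_points X v)"
  proof (rule card_inj_on_le[where f = "\<lambda>(s, t). (pt s, pt t)"])
    show "inj_on (\<lambda>(s, t). (pt s, pt t)) ?C"
      by (rule inj_on_inverseI[where g = "\<lambda>(p, q). (key p, key q)"]) (auto simp: key_pt)
    show "(\<lambda>(s, t). (pt s, pt t)) ` ?C \<subseteq> close_pairs X r \<inter> line_points X v \<times> line_points X v"
    proof (rule image_subsetI)
      fix e assume "e \<in> ?C"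
      then obtain s t where e: "e = (s, t)" "(s, t) \<in> ?C" by blast
      then have "(pt s, pt t) \<in> close_pairs X r"
        using ptQ[of s] ptQ[of t] pt_neq[of s t] by (simp add: close_pairs_def line_points_def)
      then show "(\<lambda>(s, t). (pt s, pt t)) e \<in> close_pairs X r \<inter> line_points X v \<times> line_points X v"
        using ptQ e by simp
    qed
    show "finite (close_pairs X r \<inter> line_points X v \<times> line_points X v)"
      using finite_close_pairs[OF fin] by blast
  qed
  ultimately show ?thesis using cardQ by linarith
qed

lemma line_through_two_points_unique:
  assumes "p \<in> line_points X v" "q \<in> line_points X v" "p \<in> line_points X w" "q \<in> line_points X w"
    and "p \<noteq> q"
  shows "v = w"
proof -
  obtain x y x' y' a b c d where eqs: "p = (x, y)" "q = (x', y')" "v = (a, b)" "w = (c, d)"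
    by (metis surj_pair)
  have e: "a * x - b * y = 2" "a * x' - b * y' = 2" "c * x - d * y = 2" "c * x' - d * y' = 2"
    using assms(1-4) by (auto simp: line_points_def eqs)
  have cross: "x * y' - x' * y \<noteq> 0"
  proof
    assume 0: "x * y' - x' * y = 0"
    have "(a * x' - b * y') * x - (a * x - b * y) * x' = - b * (x * y' - x' * y)"
      by (simp add: algebra_simps)
    moreover have "(a * x' - b * y') * y - (a * x - b * y) * y' = - a * (x * y' - x' * y)"
      by (simp add: algebra_simps)
    ultimately have "2 * x - 2 * x' = - b * 0" "2 * y - 2 * y' = - a * 0" by (simp_all only: e 0)
    then show False using assms(5) by (simp add: eqs)
  qed
  have "(a - c) * (x * y' - x' * y) = ((a * x - b * y) - (c * x - d * y)) * y' - ((a * x' - b * y') - (c * x' - d * y')) * y"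
    by (simp add: algebra_simps)
  moreover have "(b - d) * (x * y' - x' * y) = ((a * x - b * y) - (c * x - d * y)) * x' - ((a * x' - b * y') - (c * x' - d * y')) * x"
    by (simp add: algebra_simps)
  ultimately have "(a - c) * (x * y' - x' * y) = 0" "(b - d) * (x * y' - x' * y) = 0"
    by (simp_all only: e) simp_all
  then show ?thesis using cross by (simp add: eqs)
qed

text \<open>
  The two coordinates are independent, and \<open>card_close_rank_real\<close> bounds the choices in each.  For
  \<open>r > card X\<close>, close points have equal ranks in both coordinates and hence coincide, so that the
  bound holds for every positive \<open>r\<close>.
\<close>

lemma card_close_pairs_le:
  assumes fin: "finite X" and r: "0 < r"
  shows "real (card (close_pairs X r)) \<le> 9 * real (card X) ^ 4 / real r ^ 2"
proof (cases "r \<le> card X")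
  case True
  let ?R = "SIGMA x:X. {y \<in> X. int r * \<bar>rank_in X y - rank_in X x\<bar> \<le> int (card X)}"
  have finR: "finite ?R" using fin by auto
  have "real (card ?R) = (\<Sum>x\<in>X. real (card {y \<in> X. int r * \<bar>rank_in X y - rank_in X x\<bar> \<le> int (card X)}))"
    using fin by simp
  also have "\<dots> \<le> (\<Sum>x\<in>X. 3 * real (card X) / real r)"
    by (intro sum_mono card_close_rank_real fin r True)
  finally have R: "real (card ?R) \<le> 3 * real (card X) ^ 2 / real r"
    by (simp add: power2_eq_square mult_ac)
  have "card (close_pairs X r) \<le> card (?R \<times> ?R)"
    by (rule card_inj_on_le[where f = "\<lambda>(p, q). ((fst p, fst q), (snd p, snd q))"])
       (auto simp: inj_on_def close_pairs_def finR)
  then have "real (card (close_pairs X r)) \<le> real (card ?R) ^ 2"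
    by (simp add: card_cartesian_product power2_eq_square flip: of_nat_mult)
  also have "\<dots> \<le> (3 * real (card X) ^ 2 / real r) ^ 2"
    by (rule power_mono[OF R]) simp
  also have "\<dots> = 9 * real (card X) ^ 4 / real r ^ 2" by (simp add: power_divide power_mult_distrib)
  finally show ?thesis .
next
  case False
  have eq: "x = y" if "x \<in> X" "y \<in> X" "int r * \<bar>rank_in X y - rank_in X x\<bar> \<le> int (card X)" for x y
  proof -
    have "rank_in X y = rank_in X x"
    proof (rule ccontr)
      assume "rank_in X y \<noteq> rank_in X x"
      then have "int r * 1 \<le> int r * \<bar>rank_in X y - rank_in X x\<bar>" by (intro mult_left_mono) auto
      then show False using that(3) False by linarith
    qed
    then show ?thesis using inj_on_rank[OF fin] that by (metis inj_onD)
  qed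
  have "close_pairs X r = {}" using eq by (fastforce simp: close_pairs_def)
  then show ?thesis by simp
qed

text \<open>
  Two distinct points lie on at most one line, so the close pairs found on different lines are
  different.  The subtraction is truncated: lines with at most \<open>1 + 2 r\<close> points contribute nothing.
\<close>

lemma sum_excess_on_lines_le:
  assumes fin: "finite X" and finV: "finite V" and r: "0 < r"
  shows "real (\<Sum>v\<in>V. card (line_points X v) - (1 + 2 * r)) \<le> 9 * real (card X) ^ 4 / real r ^ 2"
proof -
  let ?c = "\<lambda>v. close_pairs X r \<inter> line_points X v \<times> line_points X v"
  have "(\<Sum>v\<in>V. card (line_points X v) - (1 + 2 * r)) \<le> (\<Sum>v\<in>V. card (?c v))"
    by (intro sum_mono) (use card_line_points_le[OF fin, of _ r] in \<open>simp add: le_diff_conv add.commute\<close>)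
  also have "\<dots> = card (\<Union>v\<in>V. ?c v)"
  proof (rule card_UN_disjoint[symmetric, OF finV])
    show "\<forall>v\<in>V. finite (?c v)" using finite_close_pairs[OF fin] by blast
    show "\<forall>v\<in>V. \<forall>w\<in>V. v \<noteq> w \<longrightarrow> ?c v \<inter> ?c w = {}"
      using line_through_two_points_unique by (fastforce simp: close_pairs_def)
  qed
  also have "\<dots> \<le> card (close_pairs X r)" by (rule card_mono[OF finite_close_pairs[OF fin]]) auto
  finally show ?thesis using card_close_pairs_le[OF fin r] by linarith
qed

text \<open>
  Summing the bound \<open>sum_excess_on_lines_le\<close> over \<open>r\<close> turns first powers of \<open>t\<close> into squares: at least
  \<open>t / 8\<close> values of \<open>r\<close> between \<open>m\<close> and \<open>t / 4\<close> have an excess of at least \<open>t / 4\<close>.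
\<close>

lemma square_le_sum_excess:
  fixes t m R :: nat
  assumes "0 < m" "8 * m \<le> t" "t \<le> R"
  shows "real t ^ 2 \<le> 32 * real (\<Sum>r\<in>{m..R}. t - (1 + 2 * r))"
proof -
  let ?I = "{m..t div 4}"
  have c: "t \<le> 8 * card ?I" using assms by simp
  have s: "t \<le> 4 * (t - (1 + 2 * r))" if "r \<in> ?I" for r using assms that by auto
  have "t * t \<le> (8 * card ?I) * t" using c by simp
  also have "\<dots> = 8 * (\<Sum>r\<in>?I. t)" by simp
  also have "\<dots> \<le> 8 * (\<Sum>r\<in>?I. 4 * (t - (1 + 2 * r)))" by (intro mult_left_mono sum_mono s) auto
  also have "\<dots> = 32 * (\<Sum>r\<in>?I. t - (1 + 2 * r))" by (simp add: sum_distrib_left)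
  also have "\<dots> \<le> 32 * (\<Sum>r\<in>{m..R}. t - (1 + 2 * r))"
    by (intro mult_left_mono sum_mono2) (use assms in auto)
  finally have "real (t * t) \<le> real (32 * (\<Sum>r\<in>{m..R}. t - (1 + 2 * r)))"
    by (simp only: of_nat_le_iff)
  then show ?thesis by (simp only: power2_eq_square of_nat_mult of_nat_numeral)
qed

text \<open>
  The term \<open>- 1 / R\<close> makes the induction telescope.
\<close>

lemma sum_inverse_squares_le:
  fixes m R :: nat
  assumes "0 < m" "m \<le> R"
  shows "(\<Sum>r\<in>{m..R}. 1 / real r ^ 2) \<le> 2 / real m - 1 / real R"
  using assms(2)
proof (induction R rule: dec_induct)
  case base
  have "1 / real m ^ 2 \<le> 1 / real m" using assms(1) by (simp add: field_simps power2_eq_square)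
  then show ?case by simp
next
  case (step R)
  have R: "real R > 0" using step assms by simp
  have "1 / (1 + real R) ^ 2 \<le> 1 / real R - 1 / (1 + real R)"
    using R by (simp add: divide_simps) (simp add: algebra_simps power2_eq_square)
  then show ?case using step by simp
qed

lemma sum_squares_rich_lines_le:
  assumes fin: "finite X" and finV: "finite V" and m: "0 < m"
  shows "(\<Sum>v\<in>{v \<in> V. 8 * m \<le> card (line_points X v)}. real (card (line_points X v)) ^ 2)
           \<le> 576 * real (card X) ^ 4 / real m"
proof -
  let ?t = "\<lambda>v. card (line_points X v)"
  let ?R = "max m (card X * card X)"
  have tR: "?t v \<le> ?R" for v
    unfolding card_cartesian_product[symmetric] le_max_iff_disj
    by (rule disjI2, rule card_mono) (use fin in \<open>auto simp: line_points_def\<close>)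
  have "(\<Sum>v\<in>{v \<in> V. 8 * m \<le> ?t v}. real (?t v) ^ 2)
      \<le> (\<Sum>v\<in>{v \<in> V. 8 * m \<le> ?t v}. 32 * real (\<Sum>r\<in>{m..?R}. ?t v - (1 + 2 * r)))"
    by (intro sum_mono square_le_sum_excess m tR) auto
  also have "\<dots> \<le> (\<Sum>v\<in>V. 32 * real (\<Sum>r\<in>{m..?R}. ?t v - (1 + 2 * r)))"
    by (intro sum_mono2 finV mult_nonneg_nonneg of_nat_0_le_iff) auto
  also have "\<dots> = 32 * (\<Sum>r\<in>{m..?R}. real (\<Sum>v\<in>V. ?t v - (1 + 2 * r)))"
    unfolding sum_distrib_left[symmetric] of_nat_sum by (subst sum.swap) simp
  also have "\<dots> \<le> 32 * (\<Sum>r\<in>{m..?R}. 9 * real (card X) ^ 4 / real r ^ 2)"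
    by (intro mult_left_mono sum_mono sum_excess_on_lines_le fin finV) (use m in auto)
  also have "\<dots> = 288 * real (card X) ^ 4 * (\<Sum>r\<in>{m..?R}. 1 / real r ^ 2)"
    by (simp add: sum_distrib_left)
  also have "\<dots> \<le> 288 * real (card X) ^ 4 * (2 / real m)"
  proof (intro mult_left_mono)
    have "(\<Sum>r\<in>{m..?R}. 1 / real r ^ 2) \<le> 2 / real m - 1 / real ?R"
      by (rule sum_inverse_squares_le[OF m]) simp
    moreover have "0 \<le> 1 / real ?R" by simp
    ultimately show "(\<Sum>r\<in>{m..?R}. 1 / real r ^ 2) \<le> 2 / real m" by linarith
  qed simp
  finally show ?thesis by simp
qed

section \<open>Differences in convex sets\<close>

text \<open>
  This is how convexity enters: an element of a convex set is determined by how far, in position and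
  in value, a later element lies from it.
\<close>

lemma convex_gaps_strict_mono:
  assumes B: "convex_real_set B" and ij: "i < j" and d: "0 < d" and jN: "j + d < card B"
  defines "x \<equiv> \<lambda>i. sorted_list_of_set B ! i"
  shows "x (i + d) - x i < x (j + d) - x j"
proof -
  have step: "x (Suc i) - x i < x (Suc (Suc i)) - x (Suc i)" if "i + 2 < card B" for i
    using B that unfolding convex_real_set_def x_def Let_def by (simp add: numeral_2_eq_2)
  have gap: "x (Suc i) - x i < x (Suc j) - x j" if "i < j" "Suc j < card B" for i j
    using that
  proof (induction j)
    case (Suc j)
    have "x (Suc j) - x j < x (Suc (Suc j)) - x (Suc j)" using Suc.prems by (intro step) simp
    then show ?case using Suc by (cases "i = j") auto
  qed simp
  show ?thesis using d jN
  proof (induction d)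
    case (Suc d)
    have g: "x (Suc (i + d)) - x (i + d) < x (Suc (j + d)) - x (j + d)"
      using ij Suc.prems by (intro gap) auto
    show ?case
    proof (cases "d = 0")
      case False
      then have "x (i + d) - x i < x (j + d) - x j" using Suc by simp
      with g show ?thesis by simp
    qed (use g in simp)
  qed simp
qed

definition diff_reps :: "real set \<Rightarrow> real \<Rightarrow> (real \<times> real) set" where
  "diff_reps B d = {p \<in> B \<times> B. fst p - snd p = d}"

definition popular_diffs :: "real set \<Rightarrow> nat \<Rightarrow> real set" where
  "popular_diffs B k = {d. k \<le> card (diff_reps B d)}"

lemma finite_diff_reps: "finite B \<Longrightarrow> finite (diff_reps B d)"
  by (auto simp: diff_reps_def)

lemma card_diff_reps_le: "finite B \<Longrightarrow> card (diff_reps B d) \<le> card B"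
  by (rule card_inj_on_le[where f = fst]) (auto simp: diff_reps_def inj_on_def)

lemma popular_diffs_subset:
  assumes "0 < k" shows "popular_diffs B k \<subseteq> (\<lambda>p. fst p - snd p) ` (B \<times> B)"
proof
  fix d assume "d \<in> popular_diffs B k"
  then have "diff_reps B d \<noteq> {}" using assms by (auto simp: popular_diffs_def)
  then obtain p where "p \<in> diff_reps B d" by blast
  then show "d \<in> (\<lambda>p. fst p - snd p) ` (B \<times> B)" unfolding diff_reps_def by blast
qed

text \<open>
  Let \<open>S\<close> be the set of popular differences.  The translates \<open>B - b\<close> with \<open>b \<in> B\<close> meet \<open>S\<close> in at least
  \<open>k * card S\<close> points altogether, because every \<open>d \<in> S\<close> lies in as many translates as it has
  representations.  The points of \<open>S\<close> in one translate form an increasing chain, so many points force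
  many pairs that are close both in position in \<open>B\<close> and in rank in \<open>S\<close>.  By convexity such a pair is
  determined by the difference of the two positions and the two elements of \<open>S\<close>, which leaves few
  pairs.  This replaces the usual incidence bound for translates of a convex curve.
\<close>

lemma convex_card_popular_diffs_le:
  assumes B: "convex_real_set B" and k: "0 < k"
  shows "real k ^ 3 * real (card (popular_diffs B k)) \<le> 1536 * real (card B) ^ 3"
proof -
  define S where "S = popular_diffs B k"
  define N where "N = card B"
  define M where "M = card S"
  define x where "x i = sorted_list_of_set B ! i" for i
  have finB: "finite B" using B by (simp add: convex_real_set_def)
  have finS: "finite S"
    unfolding S_def using popular_diffs_subset[OF k] by (rule finite_subset) (use finB in auto)
  have xB: "x ` {..<N} = B"
    unfolding x_def N_def using finB
    by (metis length_sorted_list_of_set lessThan_atLeast0 list.set_map map_nth set_sorted_list_of_set set_upt)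
  have xmono: "x i \<le> x j" if "i \<le> j" "j < N" for i j
    unfolding x_def using that finB by (intro sorted_nth_mono) (auto simp: N_def)
  have kN: "k \<le> N" if "0 < M"
  proof -
    have "S \<noteq> {}" using that by (auto simp: M_def)
    then obtain d where "d \<in> S" by blast
    then show ?thesis
      using card_diff_reps_le[OF finB, of d] by (simp add: S_def popular_diffs_def N_def)
  qed
  define Q where "Q b = {i. i < N \<and> x i - b \<in> S}" for b
  define C where "C r b = {(i, j) \<in> Q b \<times> Q b. i < j \<and> int r * \<bar>int j - int i\<bar> \<le> int N \<and>
      int r * \<bar>rank_in S (x j - b) - rank_in S (x i - b)\<bar> \<le> int M}" for r b
  have finQ: "finite (Q b)" for b by (simp add: Q_def)
  have finC: "finite (C r b)" for r b
    by (rule finite_subset[of _ "Q b \<times> Q b"]) (auto simp: C_def finQ)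
  (* Double counting of the pairs (d, b) such that d + b lies in B. *)
  have lower: "k * M \<le> (\<Sum>b\<in>B. card (Q b))"
  proof -
    have "k * M = (\<Sum>d\<in>S. k)" by (simp add: M_def)
    also have "\<dots> \<le> (\<Sum>d\<in>S. card (diff_reps B d))"
      by (intro sum_mono) (simp add: S_def popular_diffs_def)
    also have "\<dots> = card (SIGMA d:S. diff_reps B d)" using finS finite_diff_reps[OF finB] by simp
    also have "\<dots> \<le> card (SIGMA b:B. Q b)"
    proof (rule surj_card_le)
      show "finite (SIGMA b:B. Q b)" using finB finQ by auto
      show "(SIGMA d:S. diff_reps B d) \<subseteq> (\<lambda>(b, i). (x i - b, (x i, b))) ` (SIGMA b:B. Q b)"
      proof
        fix e assume "e \<in> (SIGMA d:S. diff_reps B d)"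
        then obtain d y b where e: "e = (d, (y, b))" "d \<in> S" "y \<in> B" "b \<in> B" "y - b = d"
          by (auto simp: diff_reps_def)
        obtain i where i: "i < N" "y = x i" using e(3) xB by blast
        have "(b, i) \<in> (SIGMA b:B. Q b)" using e i by (auto simp: Q_def)
        then show "e \<in> (\<lambda>(b, i). (x i - b, (x i, b))) ` (SIGMA b:B. Q b)"
          using e i by (intro image_eqI[where x = "(b, i)"]) auto
      qed
    qed
    also have "\<dots> = (\<Sum>b\<in>B. card (Q b))" using finB finQ by simp
    finally show ?thesis .
  qed
  have chain: "card (Q b) \<le> 1 + 2 * r + card (C r b)" for r b
    unfolding C_def
  proof (rule close_pairs_on_monotone_chain[OF finQ])
    show "mono_on (Q b) int \<or> antimono_on (Q b) int" by (auto simp: monotone_on_def)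
    have "mono_on (Q b) (\<lambda>i. rank_in S (x i - b))"
      by (rule monotone_onI) (auto simp: Q_def intro!: rank_mono finS xmono)
    then show "mono_on (Q b) (\<lambda>i. rank_in S (x i - b)) \<or> antimono_on (Q b) (\<lambda>i. rank_in S (x i - b))" ..
  qed (use rank_bounds[OF finS] in \<open>auto simp: Q_def M_def\<close>)
  have upper: "real (\<Sum>b\<in>B. card (C r b)) \<le> 3 * real N * real M ^ 2 / real r ^ 2"
    if r: "0 < r" "r \<le> M" for r
  proof -
    let ?R = "SIGMA s:S. {s' \<in> S. int r * \<bar>rank_in S s' - rank_in S s\<bar> \<le> int M}"
    have "(\<Sum>b\<in>B. card (C r b)) = card (SIGMA b:B. C r b)" using finB finC by simp
    also have "\<dots> \<le> card ({1..N div r} \<times> ?R)"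
    proof (rule card_inj_on_le[where f = "\<lambda>(b, i, j). (j - i, (x i - b, x j - b))"])
      show "inj_on (\<lambda>(b, i, j). (j - i, (x i - b, x j - b))) (SIGMA b:B. C r b)"
      proof (rule inj_onI)
        fix p q assume p: "p \<in> (SIGMA b:B. C r b)" and q: "q \<in> (SIGMA b:B. C r b)"
          and eq: "(\<lambda>(b, i, j). (j - i, (x i - b, x j - b))) p = (\<lambda>(b, i, j). (j - i, (x i - b, x j - b))) q"
        obtain b i j where p': "p = (b, i, j)" "i < j" "j < N" using p by (auto simp: C_def Q_def)
        obtain c g h where q': "q = (c, g, h)" "g < h" "h < N" using q by (auto simp: C_def Q_def)
        have e: "j - i = h - g" "x i - b = x g - c" "x j - b = x h - c" using eq p' q' by auto
        have jh: "j = i + (j - i)" "h = g + (j - i)" using p' q' e by auto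
        have d: "x (i + (j - i)) - x i = x (g + (j - i)) - x g" using e(2,3) jh by simp
        have "\<not> i < g" "\<not> g < i"
          using convex_gaps_strict_mono[OF B, of i g "j - i"] convex_gaps_strict_mono[OF B, of g i "j - i"]
            d p' q' jh by (auto simp: x_def N_def)
        then show "p = q" using p' q' e jh by auto
      qed
      have "j - i \<le> N div r" if "int r * \<bar>int j - int i\<bar> \<le> int N" "i < j" for i j
      proof -
        have "int (r * (j - i)) \<le> int N" using that by (simp add: of_nat_diff)
        then have "(j - i) * r \<le> N" by (simp only: of_nat_le_iff mult.commute)
        then show ?thesis using r by (simp add: less_eq_div_iff_mult_less_eq)
      qed
      then show "(\<lambda>(b, i, j). (j - i, (x i - b, x j - b))) ` (SIGMA b:B. C r b) \<subseteq> {1..N div r} \<times> ?R"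
        by (fastforce simp: C_def Q_def)
      show "finite ({1..N div r} \<times> ?R)" using finS by auto
    qed
    also have "\<dots> = (N div r) * (\<Sum>s\<in>S. card {s' \<in> S. int r * \<bar>rank_in S s' - rank_in S s\<bar> \<le> int M})"
      using finS by (simp add: card_cartesian_product)
    finally have "real (\<Sum>b\<in>B. card (C r b)) \<le> real (N div r) *
        (\<Sum>s\<in>S. real (card {s' \<in> S. int r * \<bar>rank_in S s' - rank_in S s\<bar> \<le> int M}))"
      by (simp only: of_nat_le_iff flip: of_nat_mult of_nat_sum)
    also have "\<dots> \<le> (real N / real r) * (\<Sum>s\<in>S. 3 * real M / real r)"
      using of_nat_div_le_of_nat[of N r, where 'a = real] r finS
      by (intro mult_mono sum_mono card_close_rank_real[OF finS, folded M_def] sum_nonneg) auto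
    finally show ?thesis by (simp add: M_def power2_eq_square mult_ac)
  qed
  have "real k ^ 3 * real M \<le> 1536 * real N ^ 3"
    (* If k * M is below 8 * N, no positive r is admissible, but then k \<le> N gives the bound at once. *)
  proof (cases "8 * N \<le> k * M")
    case False
    have "real k ^ 3 * real M \<le> real k ^ 2 * (8 * real N)"
    proof -
      have "real (k * M) \<le> real (8 * N)" using False by (simp only: of_nat_le_iff)
      then have "real k ^ 2 * (real k * real M) \<le> real k ^ 2 * (8 * real N)"
        by (intro mult_left_mono) auto
      then show ?thesis by (simp add: power3_eq_cube power2_eq_square mult_ac)
    qed
    moreover have "real k ^ 2 * (8 * real N) \<le> real N ^ 2 * (8 * real N)" if "0 < M"
      using kN[OF that] by (intro mult_right_mono power_mono) auto
    moreover have "real N ^ 2 * (8 * real N) \<le> 1536 * real N ^ 3"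
      by (simp add: power3_eq_cube power2_eq_square)
    ultimately show ?thesis by (cases "0 < M") (linarith, simp)
  next
    case True
    show ?thesis
    proof (cases "M = 0")
      case False
      then have kN: "k \<le> N" and M0: "0 < M" using kN by auto
      then have N0: "0 < N" using k by simp
      (* This r has the order k * M / N and is small enough that discarding 1 + 2 r points from each of
         the N translates loses at most half of the k * M points. *)
      define r where "r = k * M div (8 * N)"
      have r0: "0 < r" using True N0 by (simp add: r_def div_greater_zero_iff)
      have r8: "8 * N * r \<le> k * M" unfolding r_def by (rule times_div_less_eq_dividend)
      have "k * M < 8 * N * Suc r"
        unfolding r_def using N0 dividend_less_times_div[of "8 * N" "k * M"] by simp
      also have "\<dots> \<le> 8 * N * (2 * r)" using r0 by (intro mult_left_mono) auto
      finally have r16: "k * M \<le> 16 * N * r" by simp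
      have rM: "r \<le> M"
      proof -
        have "8 * N * r \<le> N * M" using r8 kN mult_right_mono[of k N M] by linarith
        then have "N * (8 * r) \<le> N * M" by (simp add: mult_ac)
        then show ?thesis using N0 by simp
      qed
      have "k * M \<le> (\<Sum>b\<in>B. 1 + 2 * r + card (C r b))"
        using lower sum_mono[of B "\<lambda>b. card (Q b)" "\<lambda>b. 1 + 2 * r + card (C r b)"] chain by fastforce
      also have "\<dots> = N * (1 + 2 * r) + (\<Sum>b\<in>B. card (C r b))" by (simp only: sum.distrib) (simp add: N_def)
      also have "N * (1 + 2 * r) \<le> N * (4 * r)" using r0 by (intro mult_left_mono) auto
      finally have "k * M \<le> 4 * N * r + (\<Sum>b\<in>B. card (C r b))" by simp
      then have "k * M \<le> 2 * (\<Sum>b\<in>B. card (C r b))" using r8 by simp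
      then have "real (k * M) \<le> real (2 * (\<Sum>b\<in>B. card (C r b)))" by (simp only: of_nat_le_iff)
      then have main: "real k * real M \<le> 6 * real N * real M ^ 2 / real r ^ 2"
        using upper[OF r0 rM] by simp
      have "real (k * M) \<le> real (16 * N * r)" using r16 by (simp only: of_nat_le_iff)
      then have "(real k * real M) ^ 2 \<le> (16 * real N * real r) ^ 2" by (intro power_mono) auto
      then have "(real k * real M) * (real k * real M) ^ 2
          \<le> (6 * real N * real M ^ 2 / real r ^ 2) * (16 * real N * real r) ^ 2"
        using main by (intro mult_mono) auto
      also have "\<dots> = 1536 * real N ^ 3 * real M ^ 2"
        using r0 by (simp add: power2_eq_square power3_eq_cube)
      finally have "(real k ^ 3 * real M) * real M ^ 2 \<le> 1536 * real N ^ 3 * real M ^ 2"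
        by (simp add: power2_eq_square power3_eq_cube mult_ac)
      then show ?thesis using M0 by simp
    qed simp
  qed
  then show ?thesis by (simp add: M_def N_def S_def)
qed

section \<open>The third energy\<close>

text \<open>
  This rewrites a sum of cubes of multiplicities as a sum over the level sets of popular differences.
\<close>

lemma cube_le_sum_squares: "n ^ 3 \<le> (\<Sum>k\<in>{1..n}. 3 * k ^ 2)" for n :: nat
proof (induction n)
  case (Suc n)
  have "Suc n ^ 3 \<le> n ^ 3 + 3 * Suc n ^ 2" by (simp add: power2_eq_square power3_eq_cube algebra_simps)
  with Suc show ?case by simp
qed simp

lemma harm_le_ln:
  assumes "0 < n" shows "(harm n :: real) \<le> 1 + ln (real n)"
proof -
  obtain m where "n = Suc m" using assms by (cases n) auto
  then show ?thesis using decseqD[OF decseq_harm_diff_ln, of 0 m] by (simp add: harm_expand)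
qed

definition third_energy :: "real set \<Rightarrow> nat" where
  "third_energy B = (\<Sum>d\<in>(\<lambda>p. fst p - snd p) ` (B \<times> B). card (diff_reps B d) ^ 3)"

text \<open>
  Level set \<open>k\<close> contributes \<open>k\<^sup>2\<close> times its size, that is \<open>O(N\<^sup>3 / k)\<close>, so the logarithm is a harmonic
  sum.
\<close>

lemma convex_third_energy_le:
  assumes B: "convex_real_set B" and ne: "0 < card B"
  shows "real (third_energy B) \<le> 4608 * real (card B) ^ 3 * (1 + ln (real (card B)))"
proof -
  let ?D = "(\<lambda>p. fst p - snd p) ` (B \<times> B)"
  let ?N = "card B"
  have finB: "finite B" using B by (simp add: convex_real_set_def)
  then have finD: "finite ?D" by auto
  have "third_energy B \<le> (\<Sum>d\<in>?D. \<Sum>k\<in>{1..card (diff_reps B d)}. 3 * k ^ 2)"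
    unfolding third_energy_def by (intro sum_mono cube_le_sum_squares)
  also have "\<dots> = (\<Sum>d\<in>?D. \<Sum>k\<in>{1..?N}. if d \<in> popular_diffs B k then 3 * k ^ 2 else 0)"
  proof (rule sum.cong[OF refl])
    fix d
    have "{1..card (diff_reps B d)} = {k \<in> {1..?N}. d \<in> popular_diffs B k}"
      using card_diff_reps_le[OF finB, of d] by (auto simp: popular_diffs_def)
    then show "(\<Sum>k\<in>{1..card (diff_reps B d)}. 3 * k ^ 2)
        = (\<Sum>k\<in>{1..?N}. if d \<in> popular_diffs B k then 3 * k ^ 2 else 0)"
      by (simp only: sum.inter_filter[OF finite_atLeastAtMost])
  qed
  also have "\<dots> = (\<Sum>k\<in>{1..?N}. \<Sum>d\<in>?D. if d \<in> popular_diffs B k then 3 * k ^ 2 else 0)"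
    by (rule sum.swap)
  also have "\<dots> = (\<Sum>k\<in>{1..?N}. 3 * k ^ 2 * card (popular_diffs B k))"
  proof (rule sum.cong[OF refl])
    fix k assume "k \<in> {1..?N}"
    then have "{d \<in> ?D. d \<in> popular_diffs B k} = popular_diffs B k"
      using popular_diffs_subset[of k B] by auto
    then show "(\<Sum>d\<in>?D. if d \<in> popular_diffs B k then 3 * k ^ 2 else 0) = 3 * k ^ 2 * card (popular_diffs B k)"
      by (simp add: sum.inter_filter[OF finD, symmetric])
  qed
  finally have "real (third_energy B) \<le> real (\<Sum>k\<in>{1..?N}. 3 * k ^ 2 * card (popular_diffs B k))"
    by (simp only: of_nat_le_iff)
  also have "\<dots> = (\<Sum>k\<in>{1..?N}. 3 * real k ^ 2 * real (card (popular_diffs B k)))" by simp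
  also have "\<dots> \<le> (\<Sum>k\<in>{1..?N}. 4608 * real ?N ^ 3 * inverse (real k))"
  proof (rule sum_mono)
    fix k assume "k \<in> {1..?N}"
    then have k: "0 < k" by simp
    show "3 * real k ^ 2 * real (card (popular_diffs B k)) \<le> 4608 * real ?N ^ 3 * inverse (real k)"
      using convex_card_popular_diffs_le[OF B k] k by (simp add: field_simps power2_eq_square power3_eq_cube)
  qed
  also have "\<dots> = 4608 * real ?N ^ 3 * harm ?N" by (simp add: harm_def sum_distrib_left)
  also have "\<dots> \<le> 4608 * real ?N ^ 3 * (1 + ln (real ?N))"
    by (intro mult_left_mono harm_le_ln ne) simp
  finally show ?thesis .
qed

section \<open>Weighted incidences\<close>

text \<open>
  For three given ordinates this encodes the line that contains the point formed by the second and
  third abscissa, both taken relative to the first.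
\<close>

definition diff_pair :: "real \<times> real \<times> real \<Rightarrow> real \<times> real" where
  "diff_pair = (\<lambda>(b1, b2, b3). (b3 - b1, b2 - b1))"

text \<open>
  Two triples have the same image exactly when the differences of corresponding entries agree, so a
  pair of such triples is a difference \<open>d\<close> together with three representations of \<open>d\<close>.
\<close>

lemma sum_square_diff_pair_fibres_le:
  assumes "finite B"
  defines "T \<equiv> B \<times> B \<times> B"
  shows "(\<Sum>v\<in>diff_pair ` T. card {\<beta> \<in> T. diff_pair \<beta> = v} ^ 2) \<le> third_energy B"
proof -
  let ?F = "\<lambda>v. {\<beta> \<in> T. diff_pair \<beta> = v}"
  let ?D = "(\<lambda>p. fst p - snd p) ` (B \<times> B)"
  have finT: "finite T" using assms by simp
  have "(\<Sum>v\<in>diff_pair ` T. card (?F v) ^ 2) = card (SIGMA v:diff_pair ` T. ?F v \<times> ?F v)"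
    using finT by (simp add: card_cartesian_product power2_eq_square)
  also have "\<dots> \<le> card (SIGMA d:?D. diff_reps B d \<times> diff_reps B d \<times> diff_reps B d)"
  proof (rule card_inj_on_le)
    let ?f = "\<lambda>(v :: real \<times> real, (x :: real, y :: real, z :: real), (x' :: real, y' :: real, z' :: real)).
        (x - x', (x, x'), (y, y'), (z, z'))"
    show "inj_on ?f (SIGMA v:diff_pair ` T. ?F v \<times> ?F v)"
      by (rule inj_onI) (auto simp: diff_pair_def)
    show "?f ` (SIGMA v:diff_pair ` T. ?F v \<times> ?F v)
        \<subseteq> (SIGMA d:?D. diff_reps B d \<times> diff_reps B d \<times> diff_reps B d)"
    proof (rule image_subsetI)
      fix e assume e: "e \<in> (SIGMA v:diff_pair ` T. ?F v \<times> ?F v)"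
      obtain v x y z x' y' z' where e': "e = (v, (x, y, z), (x', y', z'))" by (metis surj_pair)
      have "(x, y, z) \<in> T" "(x', y', z') \<in> T" "diff_pair (x, y, z) = diff_pair (x', y', z')"
        using e unfolding e' by auto
      moreover from this have "x - x' \<in> ?D" by (intro image_eqI[where x = "(x, x')"]) (auto simp: T_def)
      ultimately show "?f e \<in> (SIGMA d:?D. diff_reps B d \<times> diff_reps B d \<times> diff_reps B d)"
        unfolding e' by (simp add: T_def diff_pair_def diff_reps_def algebra_simps)
    qed
    show "finite (SIGMA d:?D. diff_reps B d \<times> diff_reps B d \<times> diff_reps B d)"
      using assms finite_diff_reps by auto
  qed
  also have "\<dots> = third_energy B"
    using assms finite_diff_reps[OF assms(1)]
    by (simp add: third_energy_def card_cartesian_product power3_eq_cube mult_ac)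
  finally show ?thesis .
qed

text \<open>
  Lines with fewer than \<open>8 m\<close> points are bounded by their total weight; on the rich lines, the product of
  weight and number of points is split by the inequality between the arithmetic and geometric mean.
\<close>

lemma sum_line_points_diff_pair_le:
  assumes fin: "finite X" and XB: "card X = card B" and B: "convex_real_set B"
    and ne: "0 < card B" and m: "0 < m"
  defines "N \<equiv> real (card B)"
  shows "(\<Sum>\<beta>\<in>B \<times> B \<times> B. real (card (line_points X (diff_pair \<beta>))))
    \<le> 8 * real m * N ^ 3 + real m * (4608 * N ^ 3 * (1 + ln N)) + 576 * N ^ 4 / real m ^ 2"
proof -
  define T where "T = B \<times> B \<times> B"
  define V where "V = diff_pair ` T"
  define w where "w v = card {\<beta> \<in> T. diff_pair \<beta> = v}" for v
  define t where "t v = card (line_points X v)" for v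
  have finB: "finite B" using B by (simp add: convex_real_set_def)
  have finT: "finite T" and finV: "finite V" using finB by (simp_all add: T_def V_def)
  have sum_w: "(\<Sum>v\<in>V. real (w v)) = N ^ 3"
  proof -
    have "(\<Sum>v\<in>V. w v) = card T"
      using sum.image_gen[OF finT, of "\<lambda>_. 1::nat" diff_pair] by (simp add: V_def w_def)
    also have "\<dots> = card B ^ 3" by (simp add: T_def card_cartesian_product power3_eq_cube)
    finally show ?thesis by (simp add: N_def flip: of_nat_sum)
  qed
  have sum_w2: "(\<Sum>v\<in>V. real (w v) ^ 2) \<le> 4608 * N ^ 3 * (1 + ln N)"
  proof -
    have "real (\<Sum>v\<in>V. w v ^ 2) \<le> real (third_energy B)"
      using sum_square_diff_pair_fibres_le[OF finB] by (simp only: of_nat_le_iff V_def w_def T_def)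
    also have "\<dots> \<le> 4608 * N ^ 3 * (1 + ln N)"
      unfolding N_def by (rule convex_third_energy_le[OF B ne])
    finally show ?thesis by simp
  qed
  have rich: "(\<Sum>v\<in>V. if 8 * m \<le> t v then real (t v) ^ 2 else 0) \<le> 576 * N ^ 4 / real m"
    using sum_squares_rich_lines_le[OF fin finV m]
    unfolding t_def N_def XB sum.inter_filter[OF finV] .
  have "(\<Sum>\<beta>\<in>T. real (t (diff_pair \<beta>))) = (\<Sum>v\<in>V. real (w v) * real (t v))"
    using sum.image_gen[OF finT, of "\<lambda>\<beta>. real (t (diff_pair \<beta>))" diff_pair]
    by (simp add: V_def w_def)
  also have "\<dots> \<le> (\<Sum>v\<in>V. 8 * real m * real (w v) + real m * real (w v) ^ 2
      + (if 8 * m \<le> t v then real (t v) ^ 2 else 0) / real m)"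
  proof (rule sum_mono)
    fix v
    show "real (w v) * real (t v) \<le> 8 * real m * real (w v) + real m * real (w v) ^ 2
      + (if 8 * m \<le> t v then real (t v) ^ 2 else 0) / real m"
    proof (cases "8 * m \<le> t v")
      case True
      have "0 \<le> (real m * real (w v) - real (t v)) ^ 2" by simp
      then have "2 * (real (w v) * real (t v)) * real m \<le> (real m * real (w v) ^ 2) * real m + real (t v) ^ 2"
        by (simp add: power2_diff algebra_simps power2_eq_square)
      then have "2 * (real (w v) * real (t v)) \<le> real m * real (w v) ^ 2 + real (t v) ^ 2 / real m"
        using m by (simp add: field_simps)
      moreover have "0 \<le> real (w v) * real (t v)" "0 \<le> 8 * real m * real (w v)" by simp_all
      ultimately show ?thesis unfolding if_P[OF True] by linarith
    next
      case False
      then have "real (w v) * real (t v) \<le> real (w v) * (8 * real m)" by (intro mult_left_mono) auto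
      then show ?thesis using False by (simp add: mult_ac add_increasing2)
    qed
  qed
  also have "\<dots> = 8 * real m * (\<Sum>v\<in>V. real (w v)) + real m * (\<Sum>v\<in>V. real (w v) ^ 2)
      + (\<Sum>v\<in>V. if 8 * m \<le> t v then real (t v) ^ 2 else 0) / real m"
    by (simp only: sum.distrib sum_distrib_left sum_divide_distrib)
  also have "\<dots> \<le> 8 * real m * N ^ 3 + real m * (4608 * N ^ 3 * (1 + ln N)) + (576 * N ^ 4 / real m) / real m"
    unfolding sum_w using sum_w2 rich m
    by (intro add_mono mult_left_mono divide_right_mono) auto
  finally show ?thesis by (simp add: T_def t_def power2_eq_square)
qed

text \<open>
  With \<open>m\<close> of order \<open>N^(1/3)\<close> all three terms of \<open>sum_line_points_diff_pair_le\<close> have the same order, up to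
  the logarithm.
\<close>

lemma sum_line_points_diff_pair_powr_le:
  assumes fin: "finite X" and XB: "card X = card B" and B: "convex_real_set B" and ne: "0 < card B"
  defines "N \<equiv> real (card B)"
  shows "(\<Sum>\<beta>\<in>B \<times> B \<times> B. real (card (line_points X (diff_pair \<beta>))))
    \<le> 10000 * N powr (10 / 3) * (1 + ln N)"
proof -
  define m where "m = nat \<lceil>N powr (1 / 3)\<rceil>"
  have N1: "N \<ge> 1" using ne by (simp add: N_def)
  have p1: "N powr (1 / 3) \<ge> 1" using N1 by (simp add: ge_one_powr_ge_zero)
  have m_ge: "N powr (1 / 3) \<le> real m" unfolding m_def by (rule real_nat_ceiling_ge)
  have m_le: "real m \<le> 2 * N powr (1 / 3)"
  proof -
    have "real m \<le> N powr (1 / 3) + 1" using p1 unfolding m_def by linarith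
    then show ?thesis using p1 by linarith
  qed
  have m0: "0 < m" using m_ge p1 by linarith
  have ln0: "0 \<le> ln N" using N1 by simp
  have N103: "N powr (1 / 3) * N ^ 3 = N powr (10 / 3)"
  proof -
    have "N powr (1 / 3) * N ^ 3 = N powr (1 / 3) * N powr 3" using N1 by simp
    also have "\<dots> = N powr (1 / 3 + 3)" by (rule powr_add[symmetric])
    finally show ?thesis by simp
  qed
  have mN: "real m * N ^ 3 \<le> 2 * N powr (10 / 3)"
    using mult_right_mono[OF m_le, of "N ^ 3"] N1 unfolding mult.assoc N103 by simp
  have Nm: "N ^ 4 / real m ^ 2 \<le> N powr (10 / 3)"
  proof -
    have "N ^ 4 / real m ^ 2 \<le> N ^ 4 / (N powr (1 / 3)) ^ 2"
      using m_ge p1 N1 by (intro divide_left_mono power_mono) auto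
    also have "\<dots> = N powr 4 / (N powr (1 / 3) * N powr (1 / 3))"
      using N1 by (simp add: power2_eq_square)
    also have "\<dots> = N powr (4 - (1 / 3 + 1 / 3))" by (simp only: powr_add powr_diff)
    finally show ?thesis by simp
  qed
  have "(\<Sum>\<beta>\<in>B \<times> B \<times> B. real (card (line_points X (diff_pair \<beta>))))
      \<le> 8 * real m * N ^ 3 + real m * (4608 * N ^ 3 * (1 + ln N)) + 576 * N ^ 4 / real m ^ 2"
    unfolding N_def by (rule sum_line_points_diff_pair_le[OF fin XB B ne m0])
  also have "\<dots> = 8 * (real m * N ^ 3) + 4608 * (1 + ln N) * (real m * N ^ 3) + 576 * (N ^ 4 / real m ^ 2)"
    by simp
  also have "\<dots> \<le> 8 * (2 * N powr (10 / 3)) + 4608 * (1 + ln N) * (2 * N powr (10 / 3)) + 576 * N powr (10 / 3)"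
    using ln0 by (intro add_mono mult_left_mono mN Nm) auto
  also have "\<dots> = (9808 + 9216 * ln N) * N powr (10 / 3)" by (simp add: algebra_simps)
  also have "\<dots> \<le> (10000 * (1 + ln N)) * N powr (10 / 3)" using ln0 by (intro mult_right_mono) auto
  finally show ?thesis by (simp only: mult_ac)
qed

section \<open>Counting triangles\<close>

text \<open>
  The determinant of a unit-area triangle is \<open>2\<close> or \<open>-2\<close>; exchanging two vertices fixes the sign.
\<close>

lemma unit_area_triangle_vertices:
  assumes "T \<in> unit_area_triangles (grid A B)"
  obtains a1 a2 a3 b1 b2 b3 where "{a1, a2, a3} \<subseteq> A" "{b1, b2, b3} \<subseteq> B"
    "T = {vector [a1, b1], vector [a2, b2], vector [a3, b3]}"
    "(b3 - b1) * (a2 - a1) - (b2 - b1) * (a3 - a1) = 2"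
proof -
  have T: "T \<subseteq> grid A B" "card T = 3" "measure lborel (convex hull T) = 1"
    using assms by (auto simp: unit_area_triangles_def)
  obtain p q r where pqr: "T = {p, q, r}" using T(2) by (auto simp: card_3_iff)
  obtain a1 b1 where p: "p = vector [a1, b1]" "a1 \<in> A" "b1 \<in> B" using T(1) pqr by (auto simp: grid_def)
  obtain a2 b2 where q: "q = vector [a2, b2]" "a2 \<in> A" "b2 \<in> B" using T(1) pqr by (auto simp: grid_def)
  obtain a3 b3 where r: "r = vector [a3, b3]" "a3 \<in> A" "b3 \<in> B" using T(1) pqr by (auto simp: grid_def)
  let ?d = "(b3 - b1) * (a2 - a1) - (b2 - b1) * (a3 - a1)"
  have "\<bar>?d\<bar> = 2"
    using T(3) content_triangle[of p q r] unfolding pqr by (simp add: p q r algebra_simps abs_minus_commute)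
  then consider "?d = 2" | "(b2 - b1) * (a3 - a1) - (b3 - b1) * (a2 - a1) = 2" by linarith
  then show thesis
  proof cases
    case 1
    show thesis by (rule that[of a1 a2 a3 b1 b2 b3]) (use 1 pqr p q r in auto)
  next
    case 2
    show thesis by (rule that[of a1 a3 a2 b1 b3 b2]) (use 2 pqr p q r in auto)
  qed
qed

lemma card_unit_area_triangles_le:
  assumes A: "finite A" and B: "finite B"
  shows "card (unit_area_triangles (grid A B))
    \<le> (\<Sum>a\<in>A. \<Sum>\<beta>\<in>B \<times> B \<times> B. card (line_points ((\<lambda>x. x - a) ` A) (diff_pair \<beta>)))"
proof -
  let ?L = "\<lambda>a \<beta>. line_points ((\<lambda>x. x - a) ` A) (diff_pair \<beta>)"
  let ?\<Sigma> = "SIGMA a:A. SIGMA \<beta>:B \<times> B \<times> B. ?L a \<beta>"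
  let ?f = "\<lambda>(a, (b1, b2, b3), (x, y)).
    {vector [a, b1], vector [a + x, b2], vector [a + y, b3]} :: (real ^ 2) set"
  have finL: "finite (?L a \<beta>)" for a \<beta> using A by (intro finite_line_points) simp
  have "card (unit_area_triangles (grid A B)) \<le> card ?\<Sigma>"
  proof (rule surj_card_le)
    show "finite ?\<Sigma>" using A B finL by auto
    show "unit_area_triangles (grid A B) \<subseteq> ?f ` ?\<Sigma>"
    proof
      fix T assume "T \<in> unit_area_triangles (grid A B)"
      then obtain a1 a2 a3 b1 b2 b3 where h: "{a1, a2, a3} \<subseteq> A" "{b1, b2, b3} \<subseteq> B"
        "T = {vector [a1, b1], vector [a2, b2], vector [a3, b3]}"
        "(b3 - b1) * (a2 - a1) - (b2 - b1) * (a3 - a1) = 2"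
        by (rule unit_area_triangle_vertices)
      have "(a1, (b1, b2, b3), (a2 - a1, a3 - a1)) \<in> ?\<Sigma>"
        using h by (simp add: line_points_def diff_pair_def)
      then show "T \<in> ?f ` ?\<Sigma>"
        by (rule rev_image_eqI) (simp add: h(3))
    qed
  qed
  also have "\<dots> = (\<Sum>a\<in>A. \<Sum>\<beta>\<in>B \<times> B \<times> B. card (?L a \<beta>))"
    using A B finL by simp
  finally show ?thesis .
qed

theorem theorem2:
  shows "\<exists>C::real. C > 0 \<and>
    (\<forall>(n::nat) (A::real set) (B::real set).
       n \<ge> 2 \<and> convex_real_set A \<and> convex_real_set B \<and>
       real (card A) = sqrt (real n) \<and> real (card B) = sqrt (real n) \<longrightarrow>
       real (card (unit_area_triangles (grid A B)))
         \<le> C * (real n powr (37 / 17) * ln (real n) powr (2 / 17)))"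
proof -
  (* The logarithmic factor is bounded below by its value at n = 2. *)
  define c where "c = ln (2 :: real) powr (2 / 17)"
  have c: "c > 0" by (simp add: c_def)
  show ?thesis
  proof (intro exI[of _ "520000 / c"] conjI allI impI)
    show "520000 / c > 0" using c by simp
  next
    fix n :: nat and A B :: "real set"
    assume h: "n \<ge> 2 \<and> convex_real_set A \<and> convex_real_set B \<and>
       real (card A) = sqrt (real n) \<and> real (card B) = sqrt (real n)"
    define N where "N = real (card B)"
    have n2: "real n \<ge> 2" using h by simp
    have finA: "finite A" and finB: "finite B" using h by (auto simp: convex_real_set_def)
    have AB: "card A = card B" using h by (simp flip: of_nat_eq_iff)
    have N: "N = real n powr (1 / 2)" using h by (simp add: N_def powr_half_sqrt)
    have ne: "0 < card B" using h n2 by (metis of_nat_0_less_iff real_sqrt_gt_zero zero_less_numeral order_less_le_trans)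
    have "real (card (unit_area_triangles (grid A B)))
        \<le> (\<Sum>a\<in>A. \<Sum>\<beta>\<in>B \<times> B \<times> B. real (card (line_points ((\<lambda>x. x - a) ` A) (diff_pair \<beta>))))"
      using card_unit_area_triangles_le[OF finA finB] by (simp only: of_nat_le_iff flip: of_nat_sum)
    also have "\<dots> \<le> (\<Sum>a\<in>A. 10000 * N powr (10 / 3) * (1 + ln N))"
      unfolding N_def using h finA ne
      by (intro sum_mono sum_line_points_diff_pair_powr_le) (auto simp: card_image inj_on_def AB)
    also have "\<dots> = 10000 * (1 + ln N) * (N * N powr (10 / 3))" by (simp add: AB N_def)
    also have "N * N powr (10 / 3) = real n powr (13 / 6)"
    proof -
      have "N * N powr (10 / 3) = real n powr (1 / 2) * real n powr (1 / 2 * (10 / 3))"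
        unfolding N by (simp only: powr_powr)
      also have "\<dots> = real n powr (1 / 2 + 1 / 2 * (10 / 3))" by (rule powr_add[symmetric])
      finally show ?thesis by simp
    qed
    (* 37/17 - 13/6 = 1/102, and ln x \<le> 102 * x powr (1/102). *)
    also have "10000 * (1 + ln N) * real n powr (13 / 6) \<le> 520000 * real n powr (1 / 102) * real n powr (13 / 6)"
    proof (intro mult_right_mono)
      define p where "p = real n powr (1 / 102)"
      have "ln (real n) \<le> 102 * p"
        using ln_powr_bound[of "real n" "1 / 102"] n2 by (simp add: p_def)
      moreover have "1 \<le> p" using n2 by (simp add: p_def ge_one_powr_ge_zero)
      moreover have "ln N = ln (real n) / 2" by (simp add: N ln_powr)
      ultimately have "10000 * (1 + ln N) \<le> 520000 * p" by simp
      then show "10000 * (1 + ln N) \<le> 520000 * real n powr (1 / 102)" by (simp only: p_def)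
    qed simp
    also have "\<dots> = 520000 * real n powr (37 / 17)" by (simp add: mult.assoc powr_add[symmetric])
    also have "\<dots> \<le> 520000 / c * (real n powr (37 / 17) * ln (real n) powr (2 / 17))"
    proof -
      have "c \<le> ln (real n) powr (2 / 17)" unfolding c_def using n2 by (intro powr_mono2) auto
      then have "520000 / c * (real n powr (37 / 17) * c)
          \<le> 520000 / c * (real n powr (37 / 17) * ln (real n) powr (2 / 17))"
        using c by (intro mult_left_mono) auto
      then show ?thesis using c by simp
    qed
    finally show "real (card (unit_area_triangles (grid A B)))
         \<le> 520000 / c * (real n powr (37 / 17) * ln (real n) powr (2 / 17))" .
  qed
qed

end
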